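(* There is no stable base $\mathcal{B}$ where the law $A\Rightarrow_\rho B\ \vdash_\rho\ \neg_\rho A\vee B$ holds (i.e. is true for all algorithmic statements $A,B$) for all $\mathcal{B}$-libraries $\rho$. In particular, no stable base contains Rule $P_{10}$, the rule implementing the diagram $A\Rightarrow_\rho B\,/\,\neg_\rho A\vee B$.
   Context: Framework. Algorithms are recursive algorithms in a fixed standard model. A datum is anything that can be input to an algorithm; data include natural numbers and algorithms, and every finite list of data is a datum. Every algorithm accepts exactly one input datum and either does not halt or halts with exactly one output datum. Every datum has a positive integer size, only finitely many data have a given size, and the size of a list is strictly greater than the sum of the sizes of its items. A process is a pair (algorithm, input). Every halting process has a positive integer runtime; if a process runs subprocesses in its execution, its runtime is strictly greater than the sum of the runtimes of the halting subprocesses. An algorithmic statement is a datum $[\alpha,u,v]$ with $\alpha$ an algorithm, asserting that $\alpha$ with input $u$ halts with output $v$; it is true if this is so and false otherwise, and it is directly false if $\alpha$ halts on $u$ with an output different from $v$. To say that an algorithmic statement holds is to say that it is true. $\mathcal{F}$ denotes the false statement $[\mathrm{identity},0,1]$, where $\mathrm{identity}$ outputs a copy of its input. Rules and libraries. An algorithmic sequence is an algorithm $\rho$ that halts on every positive integer $n$; its output is written $\rho_n$. A rule is an algorithm which, on every input $[H,\rho,m]$ with $H$ a finite list of algorithmic statements (hypothesis list), $\rho$ an algorithmic sequence (nominal library) and $m$ a positive integer (resource integer), halts and outputs a list of algorithmic statements (conclusion list) having $H$ as an initial sublist, and which is monotone: if $m'\ge m$ and every item of $H$ is an item of $H'$,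 then every item of the output on $[H,\rho,m]$ is an item of the output on $[H',\rho,m']$. A library is an algorithmic sequence $\rho$ such that every $\rho_n$ is a rule (not necessarily distinct); the $\rho_n$ are the rules contained in $\rho$. A rule is $\rho$-valid if for every list $H$ of true statements and every $m$, its output on $[H,\rho,m]$ consists only of true statements. A library $\rho$ is valid if all its rules are $\rho$-valid. Bases. A base is a set $\mathcal{B}$ of rules that is finite or is the set of terms of a library. A $\mathcal{B}$-library is a library containing all rules of $\mathcal{B}$. A $\mathcal{B}$-library $\rho$ is valid outside $\mathcal{B}$ if every rule in $\rho$ which is not in $\mathcal{B}$ is $\rho$-valid. A base $\mathcal{B}$ is stable if every $\mathcal{B}$-library that is valid outside $\mathcal{B}$ is valid. Deduction. Fix a recursive bijection $f:\mathbb{N}_+\to\mathbb{N}_+\times\mathbb{N}_+$. The algorithm $\mathrm{deduce}$, on input $[\Gamma,\rho,B]$ ($\Gamma$ a list of algorithmic statements, $\rho$ a library, $B$ an algorithmic statement), computes lists $H_0=\Gamma,H_1,H_2,\dots$, where for $i>0$ with $f(i)=(k,m)$ the list $H_i$ is the output of $\rho_k$ on $[H_{i-1},\rho,m]$; after computing each $H_i$ it checks whether $B$ is on $H_i$, outputs $1$ if so, and otherwise continues. The algorithmic statement $[\mathrm{deduce},[\Gamma,\rho,B],1]$ is denoted $\Gamma\vdash_\rho B$ (the notation is used for any datum $\rho$), and $A_1,\dots,A_n\vdash_\rho B$ means this with $\Gamma=[A_1,\dots,A_n]$. $A\Rightarrow_\rho B$ denotes $A\vdash_\rho B$, and $\neg_\rho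 A$ denotes $A\Rightarrow_\rho\mathcal{F}$. Disjunction. The algorithm $\mathrm{or}$ on input $[A,B]$ (two algorithmic statements) outputs $1$ if $A$ or $B$ is true, $0$ if both are directly false, and otherwise does not halt; $A\vee B$ denotes the statement $[\mathrm{or},[A,B],1]$. The negation $\neg_\rho$ binds more tightly than $\vee$. Rule diagrams. A rule implementing "$X_1,\dots,X_r\,/\,Y$" is the algorithm which on input $[H,\rho,m]$ outputs $H$ with $Y$ appended for every instance (letters ranging over algorithmic statements) whose premises $X_1,\dots,X_r$ are all on $H$; the $\rho$ in $\Rightarrow_\rho,\neg_\rho$ is the nominal library in the input. *)

theory Defs
  imports Main "HOL-Library.Nat_Bijection" "HOL-Library.Sublist"
begin

section \<open>The model of computation: Kleene's partial recursive functions\<close>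

text \<open>
  The fixed standard model is that of Kleene's \<open>\<mu>\<close>-recursive function terms. Terms carry no arity;
  a term applied to a list of arguments that is too short has no value.
\<close>

datatype recf =
    Zero
  | Succ
  | Proj nat
  | Comp recf "recf list"
  | PrimRec recf recf
  | Mini recf

inductive reval :: "recf \<Rightarrow> nat list \<Rightarrow> nat \<Rightarrow> bool" where
  "reval Zero xs 0"
| "reval Succ (x # xs) (Suc x)"
| "i < length xs \<Longrightarrow> reval (Proj i) xs (xs ! i)"
| "list_all2 (\<lambda>g v. reval g xs v) gs vs \<Longrightarrow> reval h vs y \<Longrightarrow> reval (Comp h gs) xs y"
| "reval g xs y \<Longrightarrow> reval (PrimRec g h) (0 # xs) y"
| "reval (PrimRec g h) (n # xs) v \<Longrightarrow> reval h (n # v # xs) y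
    \<Longrightarrow> reval (PrimRec g h) (Suc n # xs) y"
| "reval g (n # xs) 0 \<Longrightarrow> \<forall>i<n. \<exists>v. reval g (i # xs) (Suc v) \<Longrightarrow> reval (Mini g) xs n"

datatype datum =
    Num nat
  | Alg recf
  | Lst "datum list"

text \<open>
  A standard Goedel numbering. Both \<open>rcode\<close> and \<open>dcode\<close> are bijections onto the natural
  numbers, so that every number computed by a term is (the code of) exactly one datum.
\<close>

fun rcode :: "recf \<Rightarrow> nat" where
  "rcode Zero = 0"
| "rcode Succ = 1"
| "rcode (Proj i) = 4 * i + 2"
| "rcode (Comp h gs) = 4 * prod_encode (rcode h, list_encode (map rcode gs)) + 3"
| "rcode (PrimRec g h) = 4 * prod_encode (rcode g, rcode h) + 4"
| "rcode (Mini g) = 4 * rcode g + 5"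

fun dcode :: "datum \<Rightarrow> nat" where
  "dcode (Num n) = 3 * n"
| "dcode (Alg r) = 3 * rcode r + 1"
| "dcode (Lst ds) = 3 * list_encode (map dcode ds) + 2"

text \<open>\<open>runs \<alpha> u v\<close>: the algorithm \<open>\<alpha>\<close> with input \<open>u\<close> halts with output \<open>v\<close>.\<close>

definition runs :: "recf \<Rightarrow> datum \<Rightarrow> datum \<Rightarrow> bool" where
  "runs \<alpha> u v \<longleftrightarrow> reval \<alpha> [dcode u] (dcode v)"

definition identity :: recf where
  "identity = Proj 0"


subsection \<open>Basic facts on the model\<close>

lemma reval_unique: "reval r xs y \<Longrightarrow> reval r xs z \<Longrightarrow> y = z"
proof (induction r xs y arbitrary: z rule: reval.induct)
  case (4 xs gs vs h y)
  from "4.prems" obtain ws where ws: "list_all2 (\<lambda>g v. reval g xs v) gs ws" "reval h ws z"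
    by (auto elim: reval.cases)
  have "vs = ws"
    using "4.IH"(1) ws(1) by (auto simp: list_all2_conv_all_nth intro!: nth_equalityI)
  then show ?case using "4.IH"(2) ws(2) by blast
next
  case (5 g xs y h)
  from "5.prems" have "reval g xs z" by (auto elim: reval.cases)
  then show ?case using "5.IH" by blast
next
  case (6 g h n xs v y)
  from "6.prems" obtain w where "reval (PrimRec g h) (n # xs) w" "reval h (n # w # xs) z"
    by (auto elim: reval.cases)
  then show ?case using "6.IH" by blast
next
  case (7 g n xs)
  from "7.prems" have z: "reval g (z # xs) 0" "\<forall>i<z. \<exists>v. reval g (i # xs) (Suc v)"
    by (auto elim: reval.cases)
  show ?case
  proof (rule linorder_cases[of n z])
    assume "n < z"
    then obtain v where "reval g (n # xs) (Suc v)" using z(2) by blast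
    then have "0 = Suc v" by (rule "7.IH"(1))
    then show ?thesis by simp
  next
    assume "z < n"
    then obtain v where "\<And>x. reval g (z # xs) x \<Longrightarrow> Suc v = x" using "7.IH"(2) by blast
    then show ?thesis using z(1) by blast
  qed
qed (auto elim: reval.cases)

lemma list_encode_member_le: "x \<in> set xs \<Longrightarrow> x \<le> list_encode xs"
proof (induction xs)
  case (Cons a xs)
  show ?case
    using Cons le_prod_encode_1[of a "list_encode xs"] le_prod_encode_2[of "list_encode xs" a]
    by force
qed simp

lemma list_encode_map_inj:
  assumes "\<And>x y. x \<in> set xs \<Longrightarrow> c x = c y \<Longrightarrow> x = y" "list_encode (map c xs) = list_encode (map c ys)"
  shows "xs = ys"
proof -
  have "map c xs = map c ys" using assms(2) by (simp add: list_encode_eq)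
  then show ?thesis using assms(1)
    by (induction xs arbitrary: ys) (auto simp: Cons_eq_map_conv)
qed

lemma rcode_inject: "rcode r = rcode s \<Longrightarrow> r = s"
proof (induction r arbitrary: s)
  case Zero then show ?case by (cases s) auto
next
  case Succ then show ?case by (cases s) auto
next
  case (Proj i) then show ?case by (cases s) (auto, presburger+)
next
  case (Comp h gs)
  show ?case
  proof (cases s)
    case C: (Comp h' gs')
    then have "rcode h = rcode h'" "list_encode (map rcode gs) = list_encode (map rcode gs')"
      using Comp.prems by auto
    then show ?thesis using Comp.IH C list_encode_map_inj[of gs rcode gs'] by blast
  qed (use Comp.prems in \<open>auto, presburger+\<close>)
next
  case (PrimRec g h) then show ?case by (cases s) (auto, presburger+)
next
  case (Mini g) then show ?case by (cases s) (auto, presburger+)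
qed

lemma dcode_inject: "dcode d = dcode e \<Longrightarrow> d = e"
proof (induction d arbitrary: e)
  case (Num n) then show ?case by (cases e) (auto, presburger+)
next
  case (Alg r) then show ?case by (cases e) (auto dest: rcode_inject, presburger+)
next
  case (Lst ds)
  show ?case
  proof (cases e)
    case L: (Lst es)
    then have "list_encode (map dcode ds) = list_encode (map dcode es)"
      using Lst.prems by auto
    then show ?thesis using Lst.IH L list_encode_map_inj[of ds dcode es] by blast
  qed (use Lst.prems in \<open>auto, presburger+\<close>)
qed

lemma surj_list_encode_map:
  assumes "\<And>m. m \<le> n \<Longrightarrow> \<exists>x. c x = m"
  shows "\<exists>xs. list_encode (map c xs) = n"
proof -
  have "\<forall>m \<in> set (list_decode n). \<exists>x. c x = m"
    using assms list_encode_member_le[of _ "list_decode n"] by simp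
  then obtain g where "\<forall>m \<in> set (list_decode n). c (g m) = m" by metis
  then have "map c (map g (list_decode n)) = list_decode n" by (simp add: map_idI)
  then show ?thesis by (metis list_decode_inverse)
qed

lemma rcode_surj: "\<exists>r. rcode r = n"
proof (induction n rule: less_induct)
  case (less n)
  have IH: "\<exists>r. rcode r = m" if "m \<le> k" "k < n" for m k
    using less.IH that by simp
  consider "n = 0" | "n = 1" | k where "n = 4 * k + 2" | k where "n = 4 * k + 3"
    | k where "n = 4 * k + 4" | k where "n = 4 * k + 5"
    by atomize_elim presburger
  then show ?case
  proof cases
    case (4 k)
    obtain a b where ab: "k = prod_encode (a, b)" by (metis prod_decode_inverse surj_pair)
    have "a \<le> k" "b \<le> k" by (auto simp: ab le_prod_encode_1 le_prod_encode_2)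
    moreover have "k < n" using 4 by simp
    ultimately obtain h gs where "rcode h = a" "list_encode (map rcode gs) = b"
      using IH surj_list_encode_map[of b rcode] by (meson order_trans)
    then have "rcode (Comp h gs) = n" using 4 ab by simp
    then show ?thesis ..
  next
    case (5 k)
    obtain a b where ab: "k = prod_encode (a, b)" by (metis prod_decode_inverse surj_pair)
    have "a \<le> k" "b \<le> k" by (auto simp: ab le_prod_encode_1 le_prod_encode_2)
    moreover have "k < n" using 5 by simp
    ultimately obtain g h where "rcode g = a" "rcode h = b" using IH by meson
    then have "rcode (PrimRec g h) = n" using 5 ab by simp
    then show ?thesis ..
  next
    case (6 k)
    then obtain g where "rcode g = k" using IH[of k k] by auto
    then have "rcode (Mini g) = n" using 6 by simp
    then show ?thesis ..
  qed (metis rcode.simps(1), metis rcode.simps(2), metis rcode.simps(3))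
qed

lemma dcode_surj: "\<exists>d. dcode d = n"
proof (induction n rule: less_induct)
  case (less n)
  consider k where "n = 3 * k" | k where "n = 3 * k + 1" | k where "n = 3 * k + 2"
    by atomize_elim presburger
  then show ?case
  proof cases
    case (1 k) then show ?thesis by (metis dcode.simps(1))
  next
    case (2 k) then show ?thesis by (metis dcode.simps(2) rcode_surj)
  next
    case (3 k)
    then obtain ds where "list_encode (map dcode ds) = k"
      using surj_list_encode_map[of k dcode] less.IH by fastforce
    then have "dcode (Lst ds) = n" using 3 by simp
    then show ?thesis ..
  qed
qed

lemma bij_rcode: "bij rcode"
  by (auto intro!: bijI' rcode_inject) (metis rcode_surj)

lemma bij_dcode: "bij dcode"
  by (auto intro!: bijI' dcode_inject) (metis dcode_surj)

lemma runs_unique: "runs \<alpha> u v \<Longrightarrow> runs \<alpha> u w \<Longrightarrow> v = w"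
  unfolding runs_def by (blast intro: dcode_inject reval_unique)

lemma runs_identity: "runs identity u v \<longleftrightarrow> v = u"
proof -
  have "runs identity u u"
    unfolding runs_def identity_def using reval.intros(3)[of 0 "[dcode u]"] by simp
  then show ?thesis using runs_unique by blast
qed


section \<open>Algorithmic statements\<close>

definition stmt :: "recf \<Rightarrow> datum \<Rightarrow> datum \<Rightarrow> datum" where
  "stmt \<alpha> u v = Lst [Alg \<alpha>, u, v]"

definition is_stmt :: "datum \<Rightarrow> bool" where
  "is_stmt A \<longleftrightarrow> (\<exists>\<alpha> u v. A = stmt \<alpha> u v)"

definition true_stmt :: "datum \<Rightarrow> bool" where
  "true_stmt A \<longleftrightarrow> (\<exists>\<alpha> u v. A = stmt \<alpha> u v \<and> runs \<alpha> u v)"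

definition directly_false :: "datum \<Rightarrow> bool" where
  "directly_false A \<longleftrightarrow> (\<exists>\<alpha> u v w. A = stmt \<alpha> u v \<and> runs \<alpha> u w \<and> w \<noteq> v)"

definition Fls :: datum where
  "Fls = stmt identity (Num 0) (Num 1)"


section \<open>Rules and libraries\<close>

definition alg_sequence :: "recf \<Rightarrow> bool" where
  "alg_sequence \<rho> \<longleftrightarrow> (\<forall>n>0. \<exists>d. runs \<rho> (Num n) d)"

definition rule_input :: "datum list \<Rightarrow> datum \<Rightarrow> nat \<Rightarrow> datum" where
  "rule_input H \<rho> m = Lst [Lst H, \<rho>, Num m]"

definition admissible_input :: "datum list \<Rightarrow> recf \<Rightarrow> nat \<Rightarrow> bool" where
  "admissible_input H \<rho> m \<longleftrightarrow> (\<forall>A\<in>set H. is_stmt A) \<and> alg_sequence \<rho> \<and> m > 0"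

definition is_rule :: "recf \<Rightarrow> bool" where
  "is_rule r \<longleftrightarrow>
     (\<forall>H \<rho> m. admissible_input H \<rho> m \<longrightarrow>
        (\<exists>K. runs r (rule_input H (Alg \<rho>) m) (Lst K) \<and> (\<forall>A\<in>set K. is_stmt A) \<and> prefix H K)) \<and>
     (\<forall>H H' \<rho> m m' K K'. admissible_input H \<rho> m \<longrightarrow> admissible_input H' \<rho> m' \<longrightarrow>
        m \<le> m' \<longrightarrow> set H \<subseteq> set H' \<longrightarrow>
        runs r (rule_input H (Alg \<rho>) m) (Lst K) \<longrightarrow> runs r (rule_input H' (Alg \<rho>) m') (Lst K') \<longrightarrow>
        set K \<subseteq> set K')"

text \<open>The rules among the terms \<open>\<rho>\<^sub>n\<close>; for a library these are all the terms.\<close>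

definition rules_of :: "recf \<Rightarrow> recf set" where
  "rules_of \<rho> = {r. \<exists>n>0. runs \<rho> (Num n) (Alg r)}"

definition is_library :: "recf \<Rightarrow> bool" where
  "is_library \<rho> \<longleftrightarrow> (\<forall>n>0. \<exists>r. runs \<rho> (Num n) (Alg r) \<and> is_rule r)"

definition valid_rule :: "recf \<Rightarrow> recf \<Rightarrow> bool" where
  "valid_rule \<rho> r \<longleftrightarrow>
     (\<forall>H m K. (\<forall>A\<in>set H. true_stmt A) \<longrightarrow> m > 0 \<longrightarrow> runs r (rule_input H (Alg \<rho>) m) (Lst K) \<longrightarrow>
        (\<forall>A\<in>set K. true_stmt A))"

definition valid_library :: "recf \<Rightarrow> bool" where
  "valid_library \<rho> \<longleftrightarrow> is_library \<rho> \<and> (\<forall>r\<in>rules_of \<rho>. valid_rule \<rho> r)"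


section \<open>Bases\<close>

definition is_base :: "recf set \<Rightarrow> bool" where
  "is_base \<B> \<longleftrightarrow>
     (\<forall>r\<in>\<B>. is_rule r) \<and> (finite \<B> \<or> (\<exists>\<rho>. is_library \<rho> \<and> \<B> = rules_of \<rho>))"

definition base_library :: "recf set \<Rightarrow> recf \<Rightarrow> bool" where
  "base_library \<B> \<rho> \<longleftrightarrow> is_library \<rho> \<and> \<B> \<subseteq> rules_of \<rho>"

definition valid_outside :: "recf set \<Rightarrow> recf \<Rightarrow> bool" where
  "valid_outside \<B> \<rho> \<longleftrightarrow> (\<forall>r \<in> rules_of \<rho> - \<B>. valid_rule \<rho> r)"

definition stable_base :: "recf set \<Rightarrow> bool" where
  "stable_base \<B> \<longleftrightarrow>
     is_base \<B> \<and> (\<forall>\<rho>. base_library \<B> \<rho> \<longrightarrow> valid_outside \<B> \<rho> \<longrightarrow> valid_library \<rho>)"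


section \<open>Deduction and disjunction\<close>

definition recursive_pairing :: "(nat \<Rightarrow> nat \<times> nat) \<Rightarrow> bool" where
  "recursive_pairing f \<longleftrightarrow>
     bij_betw f {0<..} ({0<..} \<times> {0<..}) \<and>
     (\<exists>e. \<forall>n>0. runs e (Num n) (Lst [Num (fst (f n)), Num (snd (f n))]))"

text \<open>\<open>stage f \<rho> \<Gamma> i H\<close>: \<open>H\<close> is the list \<open>H\<^sub>i\<close> of the deduction from \<open>\<Gamma>\<close> in the library \<open>\<rho>\<close>.\<close>

inductive stage :: "(nat \<Rightarrow> nat \<times> nat) \<Rightarrow> recf \<Rightarrow> datum list \<Rightarrow> nat \<Rightarrow> datum list \<Rightarrow> bool"
  for f \<rho> \<Gamma> where
  "stage f \<rho> \<Gamma> 0 \<Gamma>"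
| "stage f \<rho> \<Gamma> i H \<Longrightarrow> f (Suc i) = (k, m) \<Longrightarrow> runs \<rho> (Num k) (Alg r) \<Longrightarrow>
   runs r (rule_input H (Alg \<rho>) m) (Lst H') \<Longrightarrow> stage f \<rho> \<Gamma> (Suc i) H'"

text \<open>
  An algorithm is only described by its input-output behaviour on its intended inputs:
  \<open>is_deduce f d\<close> says that \<open>d\<close> is an implementation of deduction with the pairing \<open>f\<close>, and
  \<open>is_or o'\<close> that \<open>o'\<close> is an implementation of disjunction. Such terms exist by the universal
  function theorem for \<open>recf\<close> and, for disjunction, dovetailing.
\<close>

definition is_deduce :: "(nat \<Rightarrow> nat \<times> nat) \<Rightarrow> recf \<Rightarrow> bool" where
  "is_deduce f d \<longleftrightarrow>
     (\<forall>\<Gamma> \<rho> B v. (\<forall>A\<in>set \<Gamma>. is_stmt A) \<longrightarrow> is_library \<rho> \<longrightarrow> is_stmt B \<longrightarrow>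
        (runs d (Lst [Lst \<Gamma>, Alg \<rho>, B]) v \<longleftrightarrow>
           v = Num 1 \<and> (\<exists>i H. stage f \<rho> \<Gamma> i H \<and> B \<in> set H)))"

definition is_or :: "recf \<Rightarrow> bool" where
  "is_or o' \<longleftrightarrow>
     (\<forall>A B v. is_stmt A \<longrightarrow> is_stmt B \<longrightarrow>
        (runs o' (Lst [A, B]) v \<longleftrightarrow>
           v = Num 1 \<and> (true_stmt A \<or> true_stmt B) \<or>
           v = Num 0 \<and> directly_false A \<and> directly_false B))"

text \<open>\<open>entails d \<Gamma> \<rho> B\<close> is the statement \<open>\<Gamma> \<turnstile>\<^sub>\<rho> B\<close>, where \<open>d\<close> is the deduction algorithm.\<close>

definition entails :: "recf \<Rightarrow> datum list \<Rightarrow> datum \<Rightarrow> datum \<Rightarrow> datum" where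
  "entails d \<Gamma> \<rho> B = stmt d (Lst [Lst \<Gamma>, \<rho>, B]) (Num 1)"

definition imp :: "recf \<Rightarrow> datum \<Rightarrow> datum \<Rightarrow> datum \<Rightarrow> datum" where
  "imp d \<rho> A B = entails d [A] \<rho> B"

definition neg :: "recf \<Rightarrow> datum \<Rightarrow> datum \<Rightarrow> datum" where
  "neg d \<rho> A = imp d \<rho> A Fls"

definition disj_stmt :: "recf \<Rightarrow> datum \<Rightarrow> datum \<Rightarrow> datum" where
  "disj_stmt o' A B = stmt o' (Lst [A, B]) (Num 1)"


section \<open>Rule diagrams\<close>

text \<open>
  A diagram is given by its set of instances (premises, conclusion) for each nominal library.
  The order and the multiplicity in which the conclusions are appended are left open.
\<close>

definition implements_diagram :: "recf \<Rightarrow> (datum \<Rightarrow> (datum list \<times> datum) set) \<Rightarrow> bool" where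
  "implements_diagram r D \<longleftrightarrow>
     (\<forall>H \<rho> m. admissible_input H \<rho> m \<longrightarrow>
        (\<exists>L. runs r (rule_input H (Alg \<rho>) m) (Lst (H @ L)) \<and>
             set L = {Y. \<exists>Xs. (Xs, Y) \<in> D (Alg \<rho>) \<and> set Xs \<subseteq> set H}))"

definition P10 :: "recf \<Rightarrow> recf \<Rightarrow> datum \<Rightarrow> (datum list \<times> datum) set" where
  "P10 d o' \<rho> = {([imp d \<rho> A B], disj_stmt o' (neg d \<rho> A) B) | A B. is_stmt A \<and> is_stmt B}"

end

theory Submission
  imports Defs
begin

text \<open>
  In a valid library \<open>\<rho>\<close> of a stable base, the law applied to the true statement \<open>A \<Rightarrow>\<^sub>\<rho> A\<close> makes
  \<open>\<not>\<^sub>\<rho> A \<or> A\<close> true for every \<open>A\<close>. Let the algorithm \<open>\<alpha>\<close> on input \<open>x\<close> run the deduction of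
  \<open>\<F>\<close> from \<open>[x, x, 1]\<close> in \<open>\<rho>\<close>. Then \<open>A = [\<alpha>, \<alpha>, 1]\<close> is true iff \<open>\<not>\<^sub>\<rho> A\<close> is, so both are true,
  and validity of \<open>\<rho>\<close> would make \<open>\<F>\<close> true. A valid library exists because a base is
  the set of terms of a library or finite, and a finite base becomes a library by adding the rule
  that returns its hypothesis list.
\<close>

section \<open>Total computable functions\<close>

text \<open>The term stays existentially quantified, so closure lemmas replace explicit programs.
  Only lists of length \<open>k\<close> matter, since terms carry no arity.\<close>

definition computable :: "nat \<Rightarrow> (nat list \<Rightarrow> nat) \<Rightarrow> bool" where
  "computable k g \<longleftrightarrow> (\<exists>t. \<forall>xs. length xs = k \<longrightarrow> reval t xs (g xs))"

lemma computable_cong: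
  assumes "computable k g" "\<And>xs. length xs = k \<Longrightarrow> g xs = g' xs"
  shows "computable k g'"
  using assms by (auto simp: computable_def)

lemma computable_unaryD:
  assumes "computable 1 (\<lambda>xs. g (xs ! 0))"
  shows "\<exists>t. \<forall>c. reval t [c] (g c)"
proof -
  obtain t where "\<And>xs. length xs = 1 \<Longrightarrow> reval t xs (g (xs ! 0))"
    using assms unfolding computable_def by blast
  from this[of "[_]"] show ?thesis by auto
qed

section \<open>Closure under composition, primitive recursion and minimisation\<close>

lemma computable_proj: "i < k \<Longrightarrow> computable k (\<lambda>xs. xs ! i)"
  unfolding computable_def by (metis reval.intros(3))

lemma computable_comp1:
  assumes "computable 1 h" "computable k g"
  shows "computable k (\<lambda>xs. h [g xs])"
proof -
  obtain t s where "\<And>xs. length xs = 1 \<Longrightarrow> reval t xs (h xs)" "\<And>xs. length xs = k \<Longrightarrow> reval s xs (g xs)"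
    using assms unfolding computable_def by metis
  then have "reval (Comp t [s]) xs (h [g xs])" if "length xs = k" for xs
    using that by (intro reval.intros(4)[where vs = "[g xs]"]) auto
  then show ?thesis unfolding computable_def by metis
qed

lemma computable_comp2:
  assumes "computable 2 h" "computable k g" "computable k g'"
  shows "computable k (\<lambda>xs. h [g xs, g' xs])"
proof -
  obtain t s s' where "\<And>xs. length xs = 2 \<Longrightarrow> reval t xs (h xs)"
    "\<And>xs. length xs = k \<Longrightarrow> reval s xs (g xs)" "\<And>xs. length xs = k \<Longrightarrow> reval s' xs (g' xs)"
    using assms unfolding computable_def by metis
  then have "reval (Comp t [s, s']) xs (h [g xs, g' xs])" if "length xs = k" for xs
    using that by (intro reval.intros(4)[where vs = "[g xs, g' xs]"]) auto
  then show ?thesis unfolding computable_def by metis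
qed

lemma computable_Suc:
  assumes "computable k g"
  shows "computable k (\<lambda>xs. Suc (g xs))"
proof -
  have "computable 1 (\<lambda>xs. Suc (xs ! 0))"
    unfolding computable_def by (rule exI[of _ Succ]) (auto simp: length_Suc_conv intro: reval.intros)
  from computable_comp1[OF this assms] show ?thesis by simp
qed

lemma computable_const: "computable k (\<lambda>_. n)"
proof (induction n)
  case 0
  then show ?case unfolding computable_def by (metis reval.intros(1))
qed (rule computable_Suc)

lemma computable_rec:
  assumes "computable k g" "computable (Suc (Suc k)) h"
  shows "computable (Suc k) (\<lambda>xs. rec_nat (g (tl xs)) (\<lambda>n v. h (n # v # tl xs)) (xs ! 0))"
proof -
  obtain t s where ts: "\<And>xs. length xs = k \<Longrightarrow> reval t xs (g xs)"
    "\<And>xs. length xs = Suc (Suc k) \<Longrightarrow> reval s xs (h xs)"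
    using assms unfolding computable_def by metis
  have "reval (PrimRec t s) (n # xs) (rec_nat (g xs) (\<lambda>n v. h (n # v # xs)) n)"
    if "length xs = k" for n xs
    using that by (induction n) (auto intro!: reval.intros ts)
  then show ?thesis unfolding computable_def
    by (intro exI[of _ "PrimRec t s"]) (auto simp: length_Suc_conv)
qed

lemma computable_Least:
  assumes "computable (Suc k) g" "\<And>xs. length xs = k \<Longrightarrow> \<exists>n. g (n # xs) = 0"
  shows "computable k (\<lambda>xs. LEAST n. g (n # xs) = 0)"
proof -
  obtain t where t: "\<And>xs. length xs = Suc k \<Longrightarrow> reval t xs (g xs)"
    using assms(1) unfolding computable_def by metis
  have "reval (Mini t) xs (LEAST n. g (n # xs) = 0)" if l: "length xs = k" for xs
  proof (rule reval.intros(7))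
    have "g ((LEAST n. g (n # xs) = 0) # xs) = 0"
      using assms(2)[OF l] by (rule LeastI_ex)
    then show "reval t ((LEAST n. g (n # xs) = 0) # xs) 0"
      using t[of "(LEAST n. g (n # xs) = 0) # xs"] l by simp
    \<comment> \<open>\<open>Mini\<close> demands a positive value at every point before the least
      zero, which minimality provides.\<close>
    show "\<forall>i<LEAST n. g (n # xs) = 0. \<exists>v. reval t (i # xs) (Suc v)"
      using t[of "_ # xs"] l not_less_Least by (metis length_Cons not0_implies_Suc)
  qed
  then show ?thesis unfolding computable_def by metis
qed

section \<open>Arithmetic, and coding and decoding of pairs\<close>

lemma computable_add:
  assumes "computable k g" "computable k h"
  shows "computable k (\<lambda>xs. g xs + h xs)"
proof -
  have "computable 2 (\<lambda>xs. rec_nat (tl xs ! 0) (\<lambda>n v. Suc ((n # v # tl xs) ! 1)) (xs ! 0))"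
    using computable_rec[OF computable_proj computable_Suc[OF computable_proj], of 0 1 1]
    by (simp add: numeral_2_eq_2)
  moreover have "rec_nat b (\<lambda>n. Suc) a = a + b" for a b :: nat
    by (induction a) auto
  ultimately have "computable 2 (\<lambda>xs. xs ! 0 + tl xs ! 0)" by simp
  from computable_comp2[OF this assms] show ?thesis by simp
qed

lemma computable_mult3:
  assumes "computable k g"
  shows "computable k (\<lambda>xs. 3 * g xs)"
  using computable_add[OF computable_add[OF assms assms] assms]
  by (rule computable_cong) simp

lemma computable_diff:
  assumes "computable k g" "computable k h"
  shows "computable k (\<lambda>xs. g xs - h xs)"
proof -
  \<comment> \<open>Predecessor: the recursion discards the previous value and returns its
    counter.\<close>
  have "computable 1 (\<lambda>xs. rec_nat 0 (\<lambda>n v. (n # v # tl xs) ! 0) (xs ! 0))"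
    using computable_rec[OF computable_const computable_proj, of 0 0 0] by simp
  then have "computable 1 (\<lambda>xs. xs ! 0 - 1)"
    by (rule computable_cong) (auto split: nat.split simp: gr0_conv_Suc split: nat_diff_split)
  then have "computable (Suc (Suc 1)) (\<lambda>xs. xs ! 1 - 1)"
    using computable_comp1[OF _ computable_proj[of 1 "Suc (Suc 1)"]] by fastforce
  \<comment> \<open>Iterating the predecessor gives truncated subtraction. The recursion runs over
    the subtrahend, so the arguments are swapped at the end.\<close>
  from computable_rec[OF computable_proj this, of 0]
  have "computable 2 (\<lambda>xs. rec_nat (tl xs ! 0) (\<lambda>n v. v - 1) (xs ! 0))"
    by (simp add: numeral_2_eq_2)
  moreover have "rec_nat b (\<lambda>n v. v - 1) a = b - a" for a b :: nat
    by (induction a) auto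
  ultimately have "computable 2 (\<lambda>xs. tl xs ! 0 - xs ! 0)" by simp
  from computable_comp2[OF this assms(2,1)] show ?thesis by simp
qed

lemma computable_triangle:
  assumes "computable k g"
  shows "computable k (\<lambda>xs. triangle (g xs))"
proof -
  have "computable (Suc (Suc 0)) (\<lambda>xs. xs ! 1 + Suc (xs ! 0))"
    by (intro computable_add computable_Suc computable_proj) auto
  from computable_rec[OF computable_const this, of 0]
  have "computable 1 (\<lambda>xs. rec_nat 0 (\<lambda>n v. v + Suc n) (xs ! 0))" by simp
  moreover have "rec_nat 0 (\<lambda>n v. v + Suc n) a = triangle a" for a
    by (induction a) auto
  ultimately have "computable 1 (\<lambda>xs. triangle (xs ! 0))" by simp
  from computable_comp1[OF this assms] show ?thesis by simp
qed

lemma computable_prod_encode: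
  assumes "computable k g" "computable k h"
  shows "computable k (\<lambda>xs. prod_encode (g xs, h xs))"
  unfolding prod_encode_def using assms by (auto intro!: computable_add computable_triangle)

text \<open>Shifting \<open>g\<close> by one lowers the bound \<open>N\<close>; a recursion that
  ignores its previous value then restores \<open>g 0\<close>. This makes a finite list of rules,
  padded by a constant, computable.\<close>

lemma computable_eventually_const:
  assumes "\<forall>n\<ge>N. g n = d"
  shows "computable 1 (\<lambda>xs. g (xs ! 0))"
  using assms
proof (induction N arbitrary: g)
  case 0
  then show ?case using computable_const[of 1 d] by simp
next
  case (Suc N)
  have "computable 1 (\<lambda>xs. g (Suc (xs ! 0)))"
    by (rule Suc.IH) (use Suc.prems in simp)
  from computable_rec[OF computable_const computable_comp1[OF this computable_proj], of 0 0 "g 0"]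
  have "computable 1 (\<lambda>xs. rec_nat (g 0) (\<lambda>n v. g (Suc n)) (xs ! 0))" by simp
  moreover have "rec_nat (g 0) (\<lambda>n v. g (Suc n)) m = g m" for m
    by (cases m) auto
  ultimately show ?case by simp
qed

text \<open>The code of \<open>(a, b)\<close> is \<open>triangle (a + b) + a\<close>. Hence
  \<open>a + b\<close> is the least \<open>n\<close> whose successor has a triangle number above the
  code, and subtracting \<open>triangle (a + b)\<close> leaves \<open>a\<close>. Under truncated
  subtraction, \<open>Suc c - t = 0\<close> expresses \<open>c < t\<close>.\<close>

lemma computable_prod_decode_fst:
  assumes "computable k g"
  shows "computable k (\<lambda>xs. fst (prod_decode (g xs)))"
proof -
  define K where "K xs = (LEAST n. Suc (g xs) - triangle (Suc n) = 0)" for xs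
  have dec: "fst (prod_decode (g xs)) = g xs - triangle (K xs)" for xs
  proof -
    obtain a b where ab: "g xs = prod_encode (a, b)" by (metis prod_decode_inverse surj_pair)
    have mono: "triangle n \<le> triangle m" if "n \<le> m" for n m
      using that by (induction rule: dec_induct) auto
    have "K xs = a + b" unfolding K_def
    proof (rule Least_equality)
      show "Suc (g xs) - triangle (Suc (a + b)) = 0" by (simp add: ab prod_encode_def)
    next
      fix y assume "Suc (g xs) - triangle (Suc y) = 0"
      then show "a + b \<le> y"
        using mono[of "Suc y" "a + b"] by (force simp: ab prod_encode_def not_le[symmetric])
    qed
    then show ?thesis by (simp add: ab) (simp add: prod_encode_def)
  qed
  have "\<exists>n. Suc c - triangle (Suc n) = 0" for c
    by (rule exI[of _ c]) simp
  moreover have "computable (Suc 1) (\<lambda>xs. Suc (xs ! 1) - triangle (Suc (xs ! 0)))"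
    by (intro computable_diff computable_Suc computable_triangle computable_proj) auto
  ultimately have "computable 1 (\<lambda>xs. LEAST n. Suc (xs ! 0) - triangle (Suc n) = 0)"
    using computable_Least[of 1 "\<lambda>xs. Suc (xs ! 1) - triangle (Suc (xs ! 0))"] by simp
  from computable_comp1[OF this assms] have "computable k K"
    by (simp only: K_def[abs_def] nth_Cons_0)
  then show ?thesis
    unfolding dec by (intro computable_diff computable_triangle assms)
qed

lemma computable_div3:
  assumes "computable k g"
  shows "computable k (\<lambda>xs. g xs div 3)"
proof -
  have dec: "(LEAST n. Suc (g xs) - 3 * Suc n = 0) = g xs div 3" for xs
    by (rule Least_equality) auto
  have "\<exists>n. Suc c - 3 * Suc n = 0" for c
    by (rule exI[of _ c]) simp
  moreover have "computable (Suc 1) (\<lambda>xs. Suc (xs ! 1) - 3 * Suc (xs ! 0))"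
    by (intro computable_diff computable_Suc computable_mult3 computable_proj) auto
  ultimately have "computable 1 (\<lambda>xs. LEAST n. Suc (xs ! 0) - 3 * Suc n = 0)"
    using computable_Least[of 1 "\<lambda>xs. Suc (xs ! 1) - 3 * Suc (xs ! 0)"] by simp
  from computable_comp1[OF this assms] show ?thesis using dec by simp
qed

section \<open>Valid libraries over a stable base\<close>

text \<open>A nonempty list datum has code \<open>3 * Suc p + 2\<close>, where \<open>p\<close>
  pairs the code of its head with the code of its tail. Thus \<open>c div 3 - 1\<close> recovers
  \<open>p\<close>, whose first component is already the code of \<open>Lst H\<close>.\<close>

lemma ex_identity_rule: "\<exists>r. \<forall>H \<rho> m v. runs r (rule_input H \<rho> m) v \<longleftrightarrow> v = Lst H"
proof -
  have "\<exists>r. \<forall>c. reval r [c] (fst (prod_decode (c div 3 - 1)))"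
    by (intro computable_unaryD computable_prod_decode_fst computable_diff computable_div3 computable_const
        computable_proj) auto
  then obtain r where r: "\<And>c. reval r [c] (fst (prod_decode (c div 3 - 1)))"
    by blast
  have dec: "(3 * Suc p + 2) div 3 - 1 = p" for p :: nat by simp
  have "dcode (rule_input H \<rho> m) div 3 - 1 =
      prod_encode (dcode (Lst H), list_encode [dcode \<rho>, dcode (Num m)])" for H \<rho> m
    unfolding rule_input_def dcode.simps(3)[of "[_, _, _]"] list.map list_encode.simps dec ..
  then have "runs r (rule_input H \<rho> m) (Lst H)" for H \<rho> m
    using r[of "dcode (rule_input H \<rho> m)"] by (simp add: runs_def del: dcode.simps)
  then show ?thesis using runs_unique by metis
qed

lemma ex_library_finite:
  assumes "finite \<B>" "\<forall>r\<in>\<B>. is_rule r" "is_rule s"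
  shows "\<exists>\<rho>. is_library \<rho> \<and> rules_of \<rho> = insert s \<B>"
proof -
  obtain rs where rs: "set rs = \<B>" using finite_list[OF assms(1)] by blast
  define g where "g n = (if n < length rs then rs ! n else s)" for n
  \<comment> \<open>\<open>Num n\<close> has code \<open>3 * n\<close> and library positions start
    at 1, so \<open>c div 3 - 1\<close> is the list index.\<close>
  define h where "h c = dcode (Alg (g (c div 3 - 1)))" for c
  have "\<forall>n\<ge>3 * (length rs + 1). h n = dcode (Alg s)"
    by (auto simp: h_def g_def)
  from computable_eventually_const[OF this] obtain \<rho> where \<rho>: "\<And>c. reval \<rho> [c] (h c)"
    by (blast dest: computable_unaryD)
  have "runs \<rho> (Num n) (Alg (g (n - 1)))" for n
    using \<rho>[of "3 * n"] by (simp add: runs_def h_def)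
  then have run: "runs \<rho> (Num n) v \<longleftrightarrow> v = Alg (g (n - 1))" for n v
    using runs_unique by metis
  have range: "range g = insert s \<B>"
    unfolding rs[symmetric] by (auto simp: g_def image_iff in_set_conv_nth)
  have "rules_of \<rho> = range g"
    \<comment> \<open>Index \<open>n\<close> of \<open>g\<close> is reached from the positive
      position \<open>Suc n\<close>.\<close>
    unfolding rules_of_def run by (auto intro!: exI[of _ "Suc _"])
  moreover have "is_rule (g n)" for n
    using assms(2,3) range by (metis insertE rangeI)
  ultimately show ?thesis
    using range run unfolding is_library_def by metis
qed

text \<open>By stability, validity outside the base suffices. It is vacuous if the base consists of
  all terms of a library; otherwise only the identity rule \<open>s\<close> is added, and
  \<open>s\<close> is valid for every library.\<close>

lemma stable_base_valid_library:
  assumes "stable_base \<B>"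
  shows "\<exists>\<rho>. base_library \<B> \<rho> \<and> valid_library \<rho>"
proof -
  have "\<exists>\<rho>. base_library \<B> \<rho> \<and> valid_outside \<B> \<rho>"
  proof (cases "finite \<B>")
    case True
    obtain s where s: "\<And>H \<rho> m v. runs s (rule_input H \<rho> m) v \<longleftrightarrow> v = Lst H"
      using ex_identity_rule by metis
    have "is_rule s" by (auto simp: is_rule_def s admissible_input_def)
    moreover have "valid_rule \<rho> s" for \<rho> by (simp add: valid_rule_def s)
    moreover have "\<forall>r\<in>\<B>. is_rule r"
      using assms by (simp add: stable_base_def is_base_def)
    ultimately obtain \<rho> where "is_library \<rho>" "rules_of \<rho> = insert s \<B>"
      using ex_library_finite[OF True, of s] by auto
    then have "base_library \<B> \<rho> \<and> valid_outside \<B> \<rho>"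
      using \<open>\<And>\<rho>. valid_rule \<rho> s\<close> by (auto simp: base_library_def valid_outside_def)
    then show ?thesis ..
  next
    case False
    then show ?thesis using assms
      by (auto simp: stable_base_def is_base_def base_library_def valid_outside_def)
  qed
  then show ?thesis using assms unfolding stable_base_def by blast
qed

section \<open>The diagonal argument\<close>

lemma true_stmt_stmt [simp]: "true_stmt (stmt \<alpha> u v) \<longleftrightarrow> runs \<alpha> u v"
  by (auto simp: true_stmt_def stmt_def)

lemma is_stmt_stmt [simp]: "is_stmt (stmt \<alpha> u v)"
  by (auto simp: is_stmt_def)

lemma not_true_Fls: "\<not> true_stmt Fls"
  by (simp add: Fls_def runs_identity)

lemma true_entails_iff:
  assumes "is_deduce f d" "is_library \<rho>" "\<forall>A\<in>set \<Gamma>. is_stmt A" "is_stmt B"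
  shows "true_stmt (entails d \<Gamma> (Alg \<rho>) B) \<longleftrightarrow> (\<exists>i H. stage f \<rho> \<Gamma> i H \<and> B \<in> set H)"
  using assms by (auto simp: is_deduce_def entails_def)

lemma true_imp_refl:
  assumes "is_deduce f d" "is_library \<rho>" "is_stmt A"
  shows "true_stmt (imp d (Alg \<rho>) A A)"
proof -
  \<comment> \<open>The conclusion is already on the initial list.\<close>
  have "stage f \<rho> [A] 0 [A]" by (rule stage.intros(1))
  then have "\<exists>i H. stage f \<rho> [A] i H \<and> A \<in> set H" by fastforce
  then show ?thesis
    unfolding imp_def using assms true_entails_iff[of f d \<rho> "[A]" A] by simp
qed

text \<open>Soundness of deduction: by induction on stages, valid rules keep every item
  true.\<close>

lemma valid_entails:
  assumes "recursive_pairing f" "is_deduce f d" "valid_library \<rho>"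
    and "\<forall>A\<in>set \<Gamma>. true_stmt A" "is_stmt B" "true_stmt (entails d \<Gamma> (Alg \<rho>) B)"
  shows "true_stmt B"
proof -
  have "\<forall>A\<in>set H. true_stmt A" if "stage f \<rho> \<Gamma> i H" for i H
    using that
  proof induction
    case 1
    show ?case by (rule assms(4))
  next
    case (2 i H k m r H')
    \<comment> \<open>Both \<open>rules_of\<close> and \<open>valid_rule\<close> speak only of
      positive positions and resources.\<close>
    have "f (Suc i) \<in> {0<..} \<times> {0<..}"
      using assms(1) unfolding recursive_pairing_def by (metis bij_betwE greaterThan_iff zero_less_Suc)
    then have "k > 0" "m > 0" using 2(2) by auto
    then have "valid_rule \<rho> r"
      using assms(3) 2(3) unfolding valid_library_def rules_of_def by blast
    then show ?case
      using 2 \<open>m > 0\<close> unfolding valid_rule_def by blast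
  qed
  moreover have "\<forall>A\<in>set \<Gamma>. is_stmt A"
    using assms(4) by (auto simp: true_stmt_def)
  ultimately show ?thesis
    using assms(2,3,5,6) true_entails_iff unfolding valid_library_def by blast
qed

text \<open>Self-reference comes from applying \<alpha> to itself: on \<open>x\<close> it runs
  \<open>d\<close> on \<open>u x\<close>, and for \<open>x = Alg \<alpha>\<close> this is the input
  occurring in the negation of \<open>[\<alpha>, \<alpha>, 1]\<close>.\<close>

lemma ex_self_refuting_stmt: "\<exists>A. is_stmt A \<and> (true_stmt A \<longleftrightarrow> true_stmt (neg d \<rho> A))"
proof -
  define u where "u x = Lst [Lst [Lst [x, x, Num 1]], \<rho>, Fls]" for x
  \<comment> \<open>The code of \<open>u x\<close> written out, with \<open>c\<close> for the code
    of \<open>x\<close>; the inner \<open>0\<close> is the code of the empty tail.\<close>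
  have "\<exists>t. \<forall>c. reval t [c] (3 * Suc (prod_encode (3 * Suc (prod_encode (3 * Suc (prod_encode (c,
      Suc (prod_encode (c, list_encode [dcode (Num 1)])))) + 2, 0)) + 2,
      list_encode [dcode \<rho>, dcode Fls])) + 2)"
    by (intro computable_unaryD computable_add computable_mult3 computable_Suc computable_prod_encode
        computable_proj computable_const) auto
  then obtain t where "\<And>c. reval t [c] (3 * Suc (prod_encode (3 * Suc (prod_encode (3 * Suc (prod_encode (c,
      Suc (prod_encode (c, list_encode [dcode (Num 1)])))) + 2, 0)) + 2,
      list_encode [dcode \<rho>, dcode Fls])) + 2)"
    by blast
  then have t: "reval t [dcode x] (dcode (u x))" for x
    by (simp only: u_def dcode.simps(3) list.map list_encode.simps)
  define \<alpha> where "\<alpha> = Comp d [t]"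
  have "runs \<alpha> x v \<longleftrightarrow> runs d (u x) v" for x v
  proof
    assume "runs d (u x) v"
    then show "runs \<alpha> x v"
      using t[of x] unfolding runs_def \<alpha>_def
      by (intro reval.intros(4)[where vs = "[dcode (u x)]"]) auto
  next
    assume "runs \<alpha> x v"
    then obtain w where "reval t [dcode x] w" "reval d [w] (dcode v)"
      unfolding runs_def \<alpha>_def by (auto elim!: reval.cases[of "Comp _ _"] simp: list_all2_Cons1)
    then show "runs d (u x) v" using t reval_unique unfolding runs_def by blast
  qed
  then have "true_stmt (stmt \<alpha> (Alg \<alpha>) (Num 1)) \<longleftrightarrow>
      true_stmt (neg d \<rho> (stmt \<alpha> (Alg \<alpha>) (Num 1)))"
    \<comment> \<open>\<open>stmt_def\<close> waits for the second pass, so that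
      \<open>true_stmt_stmt\<close> can first reduce truth to \<open>runs\<close>.\<close>
    by (simp add: neg_def imp_def entails_def u_def) (simp add: stmt_def)
  then show ?thesis using is_stmt_stmt by blast
qed

lemma no_excluded_middle:
  assumes "recursive_pairing f" "is_deduce f d" "is_or o'" "valid_library \<rho>"
  shows "\<exists>A. is_stmt A \<and> \<not> true_stmt (disj_stmt o' (neg d (Alg \<rho>) A) A)"
proof -
  obtain A where A: "is_stmt A" "true_stmt A \<longleftrightarrow> true_stmt (neg d (Alg \<rho>) A)"
    using ex_self_refuting_stmt by blast
  \<comment> \<open>If both held, soundness would yield \<F>. As the two are equivalent, neither is
    true, and the disjunction cannot output 1.\<close>
  have "\<not> (true_stmt A \<and> true_stmt (neg d (Alg \<rho>) A))"
    using valid_entails[OF assms(1,2,4), of "[A]" Fls] not_true_Fls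
    by (auto simp: neg_def imp_def Fls_def)
  then have "\<not> true_stmt (disj_stmt o' (neg d (Alg \<rho>) A) A)"
    using A assms(3) by (auto simp: disj_stmt_def is_or_def neg_def imp_def entails_def)
  then show ?thesis using A(1) by blast
qed

theorem proposition14p11:
  fixes f :: "nat \<Rightarrow> nat \<times> nat" and deduce or' :: recf
  assumes "recursive_pairing f"
    and "is_deduce f deduce"
    and "is_or or'"
  shows "(\<nexists>\<B>. stable_base \<B> \<and>
            (\<forall>\<rho>. base_library \<B> \<rho> \<longrightarrow>
               (\<forall>A B. is_stmt A \<longrightarrow> is_stmt B \<longrightarrow>
                  true_stmt (entails deduce [imp deduce (Alg \<rho>) A B] (Alg \<rho>)
                               (disj_stmt or' (neg deduce (Alg \<rho>) A) B)))))
       \<and> (\<nexists>\<B> r. stable_base \<B> \<and> implements_diagram r (P10 deduce or') \<and> r \<in> \<B>)"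
proof (intro conjI notI; elim exE conjE)
  fix \<B>
  assume "stable_base \<B>"
    and law: "\<forall>\<rho>. base_library \<B> \<rho> \<longrightarrow>
               (\<forall>A B. is_stmt A \<longrightarrow> is_stmt B \<longrightarrow>
                  true_stmt (entails deduce [imp deduce (Alg \<rho>) A B] (Alg \<rho>)
                               (disj_stmt or' (neg deduce (Alg \<rho>) A) B)))"
  then obtain \<rho> where \<rho>: "base_library \<B> \<rho>" "valid_library \<rho>"
    using stable_base_valid_library by blast
  obtain A where A: "is_stmt A" "\<not> true_stmt (disj_stmt or' (neg deduce (Alg \<rho>) A) A)"
    using no_excluded_middle[OF assms \<rho>(2)] by blast
  \<comment> \<open>The law is used with \<open>B = A\<close>; soundness detaches its
    conclusion.\<close>
  have "true_stmt (disj_stmt or' (neg deduce (Alg \<rho>) A) A)"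
  proof (rule valid_entails[OF assms(1,2) \<rho>(2)])
    show "\<forall>X\<in>set [imp deduce (Alg \<rho>) A A]. true_stmt X"
      using true_imp_refl[OF assms(2) _ A(1)] \<rho>(2) by (simp add: valid_library_def)
    show "true_stmt (entails deduce [imp deduce (Alg \<rho>) A A] (Alg \<rho>)
        (disj_stmt or' (neg deduce (Alg \<rho>) A) A))"
      using law \<rho>(1) A(1) by blast
  qed (simp add: disj_stmt_def)
  then show False using A(2) by blast
next
  fix \<B> r
  assume "stable_base \<B>" and r: "implements_diagram r (P10 deduce or')" "r \<in> \<B>"
  then obtain \<rho> where \<rho>: "base_library \<B> \<rho>" "valid_library \<rho>"
    using stable_base_valid_library by blast
  obtain A where A: "is_stmt A" "\<not> true_stmt (disj_stmt or' (neg deduce (Alg \<rho>) A) A)"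
    using no_excluded_middle[OF assms \<rho>(2)] by blast
  let ?H = "[imp deduce (Alg \<rho>) A A]"
  have H: "\<forall>X\<in>set ?H. true_stmt X"
    using true_imp_refl[OF assms(2) _ A(1)] \<rho>(2) by (simp add: valid_library_def)
  have "admissible_input ?H \<rho> 1"
    using \<rho>(1) by (auto simp: admissible_input_def alg_sequence_def base_library_def is_library_def
        imp_def entails_def)
  then obtain L where L: "runs r (rule_input ?H (Alg \<rho>) 1) (Lst (?H @ L))"
      "set L = {Y. \<exists>Xs. (Xs, Y) \<in> P10 deduce or' (Alg \<rho>) \<and> set Xs \<subseteq> set ?H}"
    using r(1) unfolding implements_diagram_def by blast
  have "disj_stmt or' (neg deduce (Alg \<rho>) A) A \<in> set L"
    unfolding L(2) P10_def using A(1) by fastforce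
  \<comment> \<open>Full validity of \<rho> also covers the rules of the base, so one application of
    \<open>r\<close> to the true list \<open>?H\<close> gives the contradiction.\<close>
  moreover have "valid_rule \<rho> r"
    using r(2) \<rho> by (auto simp: base_library_def valid_library_def)
  ultimately show False
    using L(1) H A(2) unfolding valid_rule_def by (metis UnCI set_append zero_less_one)
qed

end
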